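(* Let $t \geq 3$ be an integer. For every integer $i \in \{0,1,\ldots,t-1\}$ and every integer $s$ with $2^{t+1}-2^{t-i} < s < 2^{t+1}-2^{t-i-1}$, there does not exist, for any integer $v > t+1$, a Steiner $t$-$(v,t+1)$ trade of volume $s$.
   Context: Let $0<t<k<v$ be natural numbers and let $X$ be a set with $v$ elements. For $0 \le j \le v$, $P_j(X)$ denotes the set of all $j$-element subsets of $X$; elements of $P_k(X)$ are called blocks. A $t$-$(v,k)$ trade $T=\{T_1,T_2\}$ consists of two disjoint collections $T_1,T_2$ of blocks (repeated blocks within $T_1$ or within $T_2$ are allowed in general, i.e. they are finite multisets with no common block) such that every element of $P_t(X)$ is contained in the same number of blocks of $T_1$ as of $T_2$ (counted with multiplicity). Then $|T_1|=|T_2|$, and this common number is called the volume of $T$. A $t$-$(v,k)$ trade is called a Steiner $t$-$(v,k)$ trade if every element of $P_t(X)$ is contained in at most one block of $T_1$ and in at most one block of $T_2$. A Steiner $t$-$(v,t+1)$ trade is the case $k=t+1$. *)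

theory Defs
  imports "HOL-Library.Multiset" "HOL-Library.Ramsey"
begin

text \<open>
  The set of j-element subsets of X is \<^term>\<open>nsets X j\<close>. A collection of blocks is a finite
  multiset of sets, so that repeated blocks are possible, and the two parts of a trade form an
  ordered pair.
\<close>

definition degree_in :: "'a set multiset \<Rightarrow> 'a set \<Rightarrow> nat" where
  "degree_in \<B> A = size {#B \<in># \<B>. A \<subseteq> B#}"

definition is_trade ::
  "nat \<Rightarrow> nat \<Rightarrow> nat \<Rightarrow> 'a set \<Rightarrow> 'a set multiset \<times> 'a set multiset \<Rightarrow> bool" where
  "is_trade t v k X T \<longleftrightarrow>
     0 < t \<and> t < k \<and> k < v \<and> finite X \<and> card X = v \<and>
     set_mset (fst T) \<subseteq> nsets X k \<and> set_mset (snd T) \<subseteq> nsets X k \<and>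
     set_mset (fst T) \<inter> set_mset (snd T) = {} \<and>
     (\<forall>A \<in> nsets X t. degree_in (fst T) A = degree_in (snd T) A)"

definition is_steiner_trade ::
  "nat \<Rightarrow> nat \<Rightarrow> nat \<Rightarrow> 'a set \<Rightarrow> 'a set multiset \<times> 'a set multiset \<Rightarrow> bool" where
  "is_steiner_trade t v k X T \<longleftrightarrow>
     is_trade t v k X T \<and>
     (\<forall>A \<in> nsets X t. degree_in (fst T) A \<le> 1 \<and> degree_in (snd T) A \<le> 1)"

text \<open>
  The volume is read off the first part; \<open>volume_eq_size_snd\<close> below shows that, for a trade,
  the second part has the same size.
\<close>

definition volume :: "'a set multiset \<times> 'a set multiset \<Rightarrow> nat" where
  "volume T = size (fst T)"

lemma sum_degree_in:
  assumes "finite X" and "set_mset \<B> \<subseteq> nsets X k"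
  shows "(\<Sum>A \<in> nsets X t. degree_in \<B> A) = (k choose t) * size \<B>"
  using assms(2)
proof (induction \<B>)
  case empty
  show ?case by (simp add: degree_in_def)
next
  case (add B \<B>)
  have B: "B \<subseteq> X" "finite B" "card B = k"
    using add.prems by (auto simp: nsets_def)
  have fin: "finite (nsets X t)"
    using assms(1) by (simp add: finite_imp_finite_nsets)
  have "nsets X t \<inter> {A. A \<subseteq> B} = nsets B t"
    using B by (auto simp: nsets_def)
  then have c: "card (nsets X t \<inter> {A. A \<subseteq> B}) = k choose t"
    using B by simp
  have "degree_in (add_mset B \<B>) A = of_bool (A \<subseteq> B) + degree_in \<B> A" for A
    by (simp add: degree_in_def)
  then have "(\<Sum>A \<in> nsets X t. degree_in (add_mset B \<B>) A) =
      (\<Sum>A \<in> nsets X t. of_bool (A \<subseteq> B)) + (\<Sum>A \<in> nsets X t. degree_in \<B> A)"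
    by (simp add: sum.distrib)
  also have "\<dots> = (k choose t) + (k choose t) * size \<B>"
    using add fin c by (simp add: sum.If_cases of_bool_def)
  finally show ?case by simp
qed

lemma volume_eq_size_snd:
  assumes "is_trade t v k X T"
  shows "volume T = size (snd T)"
proof -
  have "(k choose t) * size (fst T) = (k choose t) * size (snd T)"
    using assms sum_degree_in[of X "fst T" k t] sum_degree_in[of X "snd T" k t]
    by (simp add: is_trade_def)
  moreover have "k choose t > 0"
    using assms by (simp add: is_trade_def)
  ultimately show ?thesis by (simp add: volume_def)
qed

end

theory Submission
  imports Defs
begin

text \<open>
  The blocks of both parts of a Steiner trade form a family \<open>S\<close> of \<open>2 * s\<close> sets such that every set
  of at most \<open>t\<close> points lies in an even number of members, that is, a codeword of weight \<open>2 * s\<close> of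
  a Reed--Muller code of minimum distance \<open>d = 2 ^ (t + 1)\<close>. The claim follows from the theorem of
  Kasami and Tokura that the weights below \<open>2 * d\<close> have the form \<open>2 * d - 2 ^ j\<close>. We prove it by
  induction on the strength with a Fourier argument. Let \<open>e = 2 * d - card S\<close> and suppose that
  \<open>e\<close> is not a power of 2. The induction hypothesis for the sections of \<open>S\<close> by the halves of a
  hyperplane shows that \<open>\<bar>F u\<bar> + e\<close> is a power of 2 for each Fourier coefficient \<open>F u\<close> of \<open>S\<close>, and
  the one for sections of codimension 2 shows that the signs of the \<open>F u\<close> form a character. By
  Fourier inversion the sum of the \<open>2 ^ m\<close> positive integers \<open>\<bar>F u\<bar>\<close> is then at most \<open>2 ^ m\<close>, hence
  \<open>card S = \<bar>F {}\<bar> \<le> 1\<close>, which is absurd.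
\<close>

section \<open>Characters of the group of finite sets\<close>

definition set_char :: "'a set \<Rightarrow> 'a set \<Rightarrow> int" where
  "set_char u B = (-1) ^ card (u \<inter> B)"

lemma set_char_empty [simp]: "set_char {} B = 1"
  by (simp add: set_char_def)

lemma set_char_cases: "set_char u B = 1 \<or> set_char u B = -1"
  by (simp add: set_char_def minus_one_power_iff)

lemma set_char_eq_prod:
  assumes "finite u"
  shows "set_char u B = (\<Prod>x\<in>u. if x \<in> B then -1 else 1)"
  using assms by (simp add: set_char_def prod.If_cases)

lemma set_char_sym_diff:
  assumes "finite u" "finite v"
  shows "set_char (sym_diff u v) B = set_char u B * set_char v B"
proof -
  have *: "set_char w B = (\<Prod>x\<in>u \<union> v. if x \<in> w \<inter> B then -1 else 1)" if "w \<subseteq> u \<union> v" for w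
  proof -
    have "(u \<union> v) \<inter> {x. x \<in> w \<inter> B} = w \<inter> B"
      using that by auto
    then show ?thesis
      using assms by (simp add: set_char_def prod.If_cases)
  qed
  show ?thesis
    unfolding *[of u, OF Un_upper1] *[of v, OF Un_upper2]
    by (subst *) (auto simp flip: prod.distrib intro!: prod.cong)
qed

text \<open>The sum over subsets factors as a product over the points of \<open>X\<close>, and a
  point lying in just one of \<open>B\<close> and \<open>C\<close> gives the factor 0.\<close>

lemma sum_set_char_orthogonal:
  assumes "finite X" "B \<subseteq> X" "C \<subseteq> X"
  shows "(\<Sum>u\<in>Pow X. set_char u B * set_char u C) = (if B = C then 2 ^ card X else 0)"
proof -
  define c where "c x = (if x \<in> B then -1 else 1) * (if x \<in> C then -1 else (1::int))" for x
  have "(\<Sum>u\<in>Pow X. set_char u B * set_char u C) = (\<Sum>u\<in>Pow X. (\<Prod>x\<in>u. c x) * (\<Prod>x\<in>X - u. 1))"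
    using assms(1)
    by (intro sum.cong) (auto simp: set_char_eq_prod finite_subset c_def prod.distrib)
  also have "\<dots> = (\<Prod>x\<in>X. c x + 1)"
    by (rule prod_add[OF assms(1), symmetric])
  also have "\<dots> = (if B = C then 2 ^ card X else 0)"
  proof (cases "B = C")
    case True
    then have "c x + 1 = 2" for x by (simp add: c_def)
    then show ?thesis using True by simp
  next
    case False
    then obtain x where "x \<in> X" "x \<in> B \<longleftrightarrow> x \<notin> C"
      using assms by blast
    then have "\<exists>x\<in>X. c x + 1 = 0"
      by (intro bexI[of _ x]) (auto simp: c_def)
    then show ?thesis using False assms(1) by (simp add: prod_zero)
  qed
  finally show ?thesis .
qed

text \<open>Singletons generate the group of subsets of \<open>X\<close>, so their signs fix all
  others. This identifies the character formed by the signs of the Fourier coefficients.\<close>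

lemma multiplicative_sign_eq_set_char:
  fixes \<epsilon> :: "'a set \<Rightarrow> int"
  assumes "finite X" and sign: "\<And>u. u \<subseteq> X \<Longrightarrow> \<epsilon> u = 1 \<or> \<epsilon> u = -1"
    and mult: "\<And>u v. u \<subseteq> X \<Longrightarrow> v \<subseteq> X \<Longrightarrow> \<epsilon> (sym_diff u v) = \<epsilon> u * \<epsilon> v"
    and "u \<subseteq> X"
  shows "\<epsilon> u = set_char u {x\<in>X. \<epsilon> {x} = -1}"
proof -
  have "finite u" using assms finite_subset by blast
  then show ?thesis using \<open>u \<subseteq> X\<close>
  proof (induction u)
    case empty
    show ?case using mult[of "{}" "{}"] sign[of "{}"] by auto
  next
    case (insert x u)
    have "insert x u = sym_diff {x} u" using insert.hyps by auto
    moreover have "set_char {x} {x\<in>X. \<epsilon> {x} = -1} = \<epsilon> {x}"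
      using sign[of "{x}"] insert.prems by (auto simp: set_char_def)
    ultimately show ?case
      using insert mult[of "{x}" u] set_char_sym_diff[of "{x}" u] by auto
  qed
qed

section \<open>Families of even strength\<close>

text \<open>For families of subsets of an \<open>m\<close>-set with \<open>q \<le> m\<close>, this
  is orthogonality mod 2 to all monomials of degree below \<open>q\<close>: the Reed-Muller code of
  order \<open>m - q\<close>, with minimum distance \<open>2 ^ q\<close>.\<close>

definition even_strength :: "nat \<Rightarrow> 'a set set \<Rightarrow> bool" where
  "even_strength q S \<longleftrightarrow> (\<forall>A. finite A \<and> card A < q \<longrightarrow> even (card {B\<in>S. A \<subseteq> B}))"

lemma even_strength_even_card:
  assumes "even_strength (Suc q) S"
  shows "even (card S)"
  using assms[unfolded even_strength_def, rule_format, of "{}"] by simp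

text \<open>Modulo 2, the indicator of \<open>set_char u B = -1\<close> is the sum over \<open>x \<in> u\<close> of the indicators
  of \<open>x \<in> B\<close>, so that it costs only one degree.\<close>
lemma even_strength_section:
  assumes "even_strength (Suc q) S" "finite S" "finite u" and c: "c = 1 \<or> c = -1"
  shows "even_strength q {B\<in>S. set_char u B = c}"
  unfolding even_strength_def
proof safe
  fix A :: "'a set"
  assume A: "finite A" "card A < q"
  let ?S = "{B\<in>S. A \<subseteq> B}"
  let ?h = "\<lambda>c. {B\<in>?S. set_char u B = c}"
  have fin: "finite ?S" using assms(2) by simp
  have "even (card {B\<in>?S. insert x A \<subseteq> B})" for x
  proof -
    have "card (insert x A) < Suc q" using A by (simp add: card_insert_if)
    then have "even (card {B\<in>S. insert x A \<subseteq> B})"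
      using assms(1) A(1) unfolding even_strength_def by blast
    moreover have "{B\<in>?S. insert x A \<subseteq> B} = {B\<in>S. insert x A \<subseteq> B}" by auto
    ultimately show ?thesis by simp
  qed
  then have "even (\<Sum>x\<in>u. card {B\<in>?S. x \<in> B})"
    by (intro dvd_sum) (smt (verit, best) Collect_cong insert_subset mem_Collect_eq)
  also have "(\<Sum>x\<in>u. card {B\<in>?S. x \<in> B}) = (\<Sum>B\<in>?S. card {x\<in>u. x \<in> B})"
    by (rule sum_multicount_gen[OF assms(3) fin]) simp
  finally have "even (card {B\<in>?S. odd (card {x\<in>u. x \<in> B})})"
    by (simp only: even_sum_iff[OF fin])
  moreover have "odd (card {x\<in>u. x \<in> B}) \<longleftrightarrow> set_char u B = -1" for B
    by (simp add: set_char_def minus_one_power_iff Int_def)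
  ultimately have odd_half: "even (card (?h (-1)))"
    by (simp only:)
  have "even (card {B\<in>S. A \<subseteq> B})"
    using assms(1) A unfolding even_strength_def by simp
  moreover have "card (?h 1 \<union> ?h (-1)) = card (?h 1) + card (?h (-1))"
    by (rule card_Un_disjoint) (use assms(2) in auto)
  moreover have "?h 1 \<union> ?h (-1) = ?S" using set_char_cases by auto
  ultimately have "even (card (?h c))" using odd_half c by auto
  moreover have "{B\<in>{B\<in>S. set_char u B = c}. A \<subseteq> B} = ?h c" by auto
  ultimately show "even (card {B\<in>{B\<in>S. set_char u B = c}. A \<subseteq> B})" by simp
qed

section \<open>Fourier coefficients of a family and of its sections\<close>

definition fourier :: "'a set set \<Rightarrow> 'a set \<Rightarrow> int" where
  "fourier S u = (\<Sum>B\<in>S. set_char u B)"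

text \<open>The indicator of \<open>set_char u B = c\<close> is
  \<open>(1 + c * set_char u B) / 2\<close>; doubling keeps the identity integral.\<close>

lemma card_section_eq:
  assumes "finite S" "c = 1 \<or> c = -1"
  shows "2 * int (card {B\<in>S. set_char u B = c}) = int (card S) + c * fourier S u"
proof -
  have "2 * int (card {B\<in>S. set_char u B = c}) = (\<Sum>B\<in>S. 2 * of_bool (set_char u B = c))"
    using assms(1) by (simp add: sum_distrib_left[symmetric] Int_def)
  also have "\<dots> = (\<Sum>B\<in>S. 1 + c * set_char u B)"
  proof (rule sum.cong)
    fix B
    show "2 * of_bool (set_char u B = c) = 1 + c * set_char u B"
      using set_char_cases[of u B] assms(2) by auto
  qed simp
  also have "\<dots> = int (card S) + c * fourier S u"
    by (simp add: sum.distrib fourier_def sum_distrib_left)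
  finally show ?thesis .
qed

lemma fourier_section_eq:
  assumes "finite S" "c = 1 \<or> c = -1" "finite u" "finite v"
  shows "2 * fourier {B\<in>S. set_char u B = c} v = fourier S v + c * fourier S (sym_diff u v)"
proof -
  have "2 * fourier {B\<in>S. set_char u B = c} v =
      (\<Sum>B\<in>S. 2 * (if set_char u B = c then set_char v B else 0))"
    using assms(1) by (simp add: fourier_def sum.inter_filter sum_distrib_left)
  also have "\<dots> = (\<Sum>B\<in>S. set_char v B + c * set_char (sym_diff u v) B)"
  proof (rule sum.cong)
    fix B
    show "2 * (if set_char u B = c then set_char v B else 0) =
        set_char v B + c * set_char (sym_diff u v) B"
      using set_char_cases[of u B] assms(2) by (auto simp: set_char_sym_diff[OF assms(3,4)])
  qed simp
  also have "\<dots> = fourier S v + c * fourier S (sym_diff u v)"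
    by (simp add: sum.distrib fourier_def sum_distrib_left)
  finally show ?thesis .
qed

lemma fourier_inversion:
  assumes "finite X" "S \<subseteq> Pow X" "C \<subseteq> X"
  shows "(\<Sum>u\<in>Pow X. set_char u C * fourier S u) = (if C \<in> S then 2 ^ card X else 0)"
proof -
  have fin: "finite S" using assms finite_subset by blast
  have "(\<Sum>u\<in>Pow X. set_char u C * fourier S u) =
      (\<Sum>B\<in>S. \<Sum>u\<in>Pow X. set_char u C * set_char u B)"
    by (simp add: fourier_def sum_distrib_left) (rule sum.swap)
  also have "\<dots> = (\<Sum>B\<in>S. if C = B then 2 ^ card X else 0)"
    using assms by (intro sum.cong sum_set_char_orthogonal) auto
  also have "\<dots> = (if C \<in> S then 2 ^ card X else 0)"
    using fin by simp
  finally show ?thesis .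
qed

section \<open>Weights below twice the minimum distance\<close>

lemma ex_power2_bracket:
  fixes e :: int
  assumes "0 < e" "\<And>k. e \<noteq> 2 ^ k"
  obtains a where "2 ^ a < e" "e < 2 ^ Suc a"
proof -
  obtain n where n: "e = int n" "n \<ge> 1"
    using assms(1) by (cases e rule: int_cases2) auto
  obtain a where "2 ^ a \<le> n" "n < 2 ^ (a + 1)"
    using ex_power_ivl1[of 2 n] n(2) by auto
  then have "int (2 ^ a) \<le> int n" "int n < int (2 ^ (a + 1))"
    by (simp_all only: of_nat_le_iff of_nat_less_iff)
  then have "2 ^ a \<le> e" "e < 2 ^ Suc a"
    by (simp_all add: n(1))
  with assms(2)[of a] show thesis using that[of a] by simp
qed

text \<open>The empty family is the case \<open>j = Suc q\<close>. Sections by two hyperplanes lower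
  \<open>q\<close> by two, hence strong induction with two base cases.\<close>

theorem Kasami_Tokura_weights:
  assumes "finite X" "S \<subseteq> Pow X" "even_strength q S" "card S < 2 ^ Suc q"
  shows "\<exists>j. int (card S) = 2 ^ Suc q - 2 ^ j"
  using assms(2-4)
proof (induction q arbitrary: S rule: less_induct)
  case (less q)
  have fin: "finite S" using less.prems(1) assms(1) finite_subset by blast
  consider "q = 0" | "q = 1" | r where "q = Suc (Suc r)"
    by (metis One_nat_def not0_implies_Suc)
  then show ?case
  proof cases
    case 1
    then have "card S = 0 \<or> card S = 1" using less.prems by auto
    then show ?thesis
      using 1 by (auto intro: exI[of _ 0] exI[of _ 1])
  next
    case 2
    then have "even (card S)" "card S < 4"
      using less.prems even_strength_even_card[of 0] by auto
    then have "card S = 0 \<or> card S = 2" by presburger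
    then show ?thesis
      using 2 by (auto intro: exI[of _ 1] exI[of _ 2])
  next
    case (3 r)
    define N where "N = int (card S)"
    define e where "e = 2 ^ Suc q - N"
    define F where "F = fourier S"
    have "int (card S) < int (2 ^ Suc q)"
      using less.prems(3) by (simp only: of_nat_less_iff)
    then have "e > 0" by (simp add: e_def N_def)
    have F0: "F {} = N" by (simp add: F_def N_def fourier_def)
    show ?thesis
    proof (rule ccontr)
      assume contra: "\<not> ?thesis"
      have not_pow: "e \<noteq> 2 ^ k" for k
        using contra by (auto simp: e_def N_def algebra_simps)
      obtain a where a: "2 ^ a < e" "e < 2 ^ Suc a"
        using ex_power2_bracket[OF \<open>e > 0\<close> not_pow] by blast
      have finu: "finite u" if "u \<subseteq> X" for u
        using that assms(1) finite_subset by blast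
      define H where "H u c = {B\<in>S. set_char u B = c}" for u c
      have H: "even_strength (Suc r) (H u c)" "H u c \<subseteq> Pow X" "finite (H u c)"
        "2 * int (card (H u c)) = N + c * F u"
        if "u \<subseteq> X" "c = 1 \<or> c = -1" for u c
        using even_strength_section[of "Suc r" S u c] card_section_eq[of S c u]
          less.prems(1,2) fin finu[OF that(1)] that(2) 3
        by (auto simp: H_def N_def F_def)
      have pow: "\<exists>k. \<bar>F u\<bar> + e = 2 ^ k" if u: "u \<subseteq> X" for u
      proof -
        \<comment> \<open>This sign selects the smaller half, of size
          \<open>(N - \<bar>F u\<bar>) / 2 < 2 ^ q\<close>, to which the induction hypothesis
          applies.\<close>
        define c where "c = (if F u > 0 then -1 else 1 :: int)"
        have c: "c = 1 \<or> c = -1" "c * F u = - \<bar>F u\<bar>" by (auto simp: c_def)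
        note Hu = H[OF u c(1)]
        have "2 * int (card (H u c)) < 2 * 2 ^ q"
          using Hu(4) c(2) \<open>e > 0\<close> by (simp add: e_def)
        then have "int (card (H u c)) < int (2 ^ Suc (Suc r))"
          using 3 by simp
        then have "card (H u c) < 2 ^ Suc (Suc r)"
          by (simp only: of_nat_less_iff)
        then obtain j where "int (card (H u c)) = 2 ^ Suc (Suc r) - 2 ^ j"
          using less.IH[of "Suc r" "H u c"] Hu 3 by auto
        then have "\<bar>F u\<bar> + e = 2 ^ Suc j"
          using Hu(4) c(2) 3 by (simp add: e_def)
        then show ?thesis by blast
      qed
      have nonzero: "F u \<noteq> 0" if "u \<subseteq> X" for u
        using pow[OF that] not_pow by auto
      \<comment> \<open>A power of 2 that is at least \<open>e\<close> exceeds \<open>2 ^ a\<close>,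
        so its exponent is at least \<open>Suc a\<close>.\<close>
      have pow_dvd: "2 ^ Suc a dvd \<bar>F u\<bar> + e" "2 ^ Suc a \<le> \<bar>F u\<bar> + e" if u: "u \<subseteq> X" for u
      proof -
        obtain k where k: "\<bar>F u\<bar> + e = 2 ^ k" using pow[OF u] by blast
        then have "(2::int) ^ a < 2 ^ k" using a(1) by linarith
        then have "Suc a \<le> k" by simp
        then show "2 ^ Suc a dvd \<bar>F u\<bar> + e" "2 ^ Suc a \<le> \<bar>F u\<bar> + e"
          unfolding k by (simp_all only: le_imp_power_dvd power_increasing one_le_numeral)
      qed
      have mult: "sgn (F (sym_diff u v)) = sgn (F u) * sgn (F v)"
        if u: "u \<subseteq> X" and v: "v \<subseteq> X" for u v
      proof (rule ccontr)
        let ?w = "sym_diff u v"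
        assume neq: "sgn (F ?w) \<noteq> sgn (F u) * sgn (F v)"
        have w: "?w \<subseteq> X" using u v by auto
        \<comment> \<open>These signs make the terms of \<open>u\<close> and \<open>v\<close>
          negative; the failure of multiplicativity makes the term of \<open>?w\<close> negative
          too, so all three reduce \<open>card K\<close>.\<close>
        define c d where "c = - sgn (F u)" and "d = - sgn (F v)"
        have c: "c = 1 \<or> c = -1" and d: "d = 1 \<or> d = -1"
          using nonzero u v by (auto simp: c_def d_def sgn_if)
        have signs: "c * F u = - \<bar>F u\<bar>" "d * F v = - \<bar>F v\<bar>" "c * d * F ?w = - \<bar>F ?w\<bar>"
          using neq nonzero[OF u] nonzero[OF v] nonzero[OF w]
          by (auto simp: c_def d_def sgn_if split: if_splits)
        define K where "K = {B\<in>H u c. set_char v B = d}"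
        note Hu = H[OF u c]
        have K: "even_strength r K" "K \<subseteq> Pow X"
          using even_strength_section[OF Hu(1,3) finu[OF v] d] Hu(2) by (auto simp: K_def)
        have "2 * int (card K) = int (card (H u c)) + d * fourier (H u c) v"
          unfolding K_def by (rule card_section_eq[OF Hu(3) d])
        then have "4 * int (card K) = N + c * F u + d * (2 * fourier (H u c) v)"
          using Hu(4) by simp
        moreover have "2 * fourier (H u c) v = F v + c * F ?w"
          unfolding H_def F_def by (rule fourier_section_eq[OF fin c finu[OF u] finu[OF v]])
        ultimately have "4 * int (card K) = N + c * F u + d * (F v + c * F ?w)"
          by (simp only:)
        then have cardK: "4 * int (card K) = N - \<bar>F u\<bar> - \<bar>F v\<bar> - \<bar>F ?w\<bar>"
          using signs by (simp add: algebra_simps)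
        let ?s = "(\<bar>F u\<bar> + e) + (\<bar>F v\<bar> + e) + (\<bar>F ?w\<bar> + e)"
        \<comment> \<open>The three summands are each at least \<open>2 ^ Suc a\<close>, while
          \<open>e\<close> is below it.\<close>
        have large: "?s - 2 * e > 2 ^ Suc a"
          using pow_dvd(2)[OF u] pow_dvd(2)[OF v] pow_dvd(2)[OF w] a(2) by linarith
        have eq: "4 * int (card K) = 4 * 2 ^ Suc r - (?s - 2 * e)"
          using cardK 3 by (simp add: e_def)
        then have "4 * int (card K) < 4 * 2 ^ Suc r"
          using large zero_less_power[of "2::int" "Suc a"] by linarith
        then have "int (card K) < int (2 ^ Suc r)" by simp
        then have "card K < 2 ^ Suc r" by (simp only: of_nat_less_iff)
        then obtain j where "int (card K) = 2 ^ Suc r - 2 ^ j"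
          using less.IH[of r K] K 3 by auto
        \<comment> \<open>Both \<open>?s\<close> and this power of 2 are multiples of
          \<open>2 ^ Suc a\<close>, so \<open>2 ^ a\<close> divides \<open>e\<close>, although
          \<open>e\<close> lies strictly between \<open>2 ^ a\<close> and its double.\<close>
        then have j: "?s - 2 * e = 2 ^ (j + 2)" using eq by simp
        then have "Suc a \<le> j + 2"
          using large by (metis less_imp_le_nat one_less_numeral_iff power_strict_increasing_iff
              semiring_norm(76))
        then have "2 ^ Suc a dvd ?s - 2 * e"
          unfolding j by (rule le_imp_power_dvd)
        moreover have "2 ^ Suc a dvd ?s"
          by (rule dvd_add[OF dvd_add[OF pow_dvd(1)[OF u] pow_dvd(1)[OF v]] pow_dvd(1)[OF w]])
        ultimately have "2 ^ Suc a dvd ?s - (?s - 2 * e)"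
          by (rule dvd_diff[rotated])
        then have "2 ^ Suc a dvd 2 * e" by (simp only: diff_diff_eq2 add_diff_cancel_left')
        then have "2 ^ a dvd e" by simp
        then obtain n where "e = 2 ^ a * n" by (elim dvdE)
        with a have "1 < n" "n < 2" by auto
        then show False by simp
      qed
      define C where "C = {x\<in>X. sgn (F {x}) = -1}"
      have sgn_char: "sgn (F u) = set_char u C" if "u \<subseteq> X" for u
        unfolding C_def
        by (rule multiplicative_sign_eq_set_char[OF assms(1) _ mult that])
          (use nonzero in \<open>auto simp: sgn_if\<close>)
      \<comment> \<open>Since the signs are the values of a character at \<open>C\<close>, the sum
        of absolute values is the inverse transform at \<open>C\<close>.\<close>
      have "(\<Sum>u\<in>Pow X. \<bar>F u\<bar>) = (\<Sum>u\<in>Pow X. set_char u C * F u)"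
        using sgn_char by (intro sum.cong) (auto simp: abs_sgn mult.commute)
      also have "\<dots> \<le> 2 ^ card X"
        unfolding F_def by (subst fourier_inversion) (use assms(1) less.prems(1) in \<open>auto simp: C_def\<close>)
      finally have upper: "(\<Sum>u\<in>Pow X. \<bar>F u\<bar>) \<le> 2 ^ card X" .
      \<comment> \<open>Nonzero integers have absolute value at least 1, so all terms are
        nonnegative, while \<open>upper\<close> bounds their total by 0.\<close>
      have "(\<Sum>u\<in>Pow X. \<bar>F u\<bar> - 1) \<ge> \<bar>F {}\<bar> - 1"
        by (rule member_le_sum) (use nonzero assms(1) in \<open>force+\<close>)
      then have "N \<le> 1"
        using upper F0 assms(1) by (simp add: sum_subtractf card_Pow)
      moreover have "even N"
        using even_strength_even_card less.prems(2) 3 by (auto simp: N_def)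
      moreover have "N \<noteq> 0"
        using nonzero[of "{}"] F0 by simp
      moreover have "N \<ge> 0" by (simp add: N_def)
      ultimately show False by presburger
    qed
  qed
qed

section \<open>Trades\<close>

lemma degree_in_add_mset:
  "degree_in (add_mset B T) A = of_bool (A \<subseteq> B) + degree_in T A"
  by (simp add: degree_in_def)

text \<open>Double counting: a block of size \<open>k\<close> containing \<open>A\<close> has
  \<open>k - card A\<close> further points \<open>x\<close>.\<close>

lemma sum_degree_in_insert:
  assumes "finite X" "A \<subseteq> X" "set_mset T \<subseteq> nsets X k"
  shows "(\<Sum>x\<in>X - A. degree_in T (insert x A)) = (k - card A) * degree_in T A"
  using assms(3)
proof (induction T)
  case empty
  show ?case by (simp add: degree_in_def)
next
  case (add B T)
  have B: "B \<subseteq> X" "finite B" "card B = k"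
    using add.prems by (auto simp: nsets_def)
  have "(\<Sum>x\<in>X - A. of_bool (insert x A \<subseteq> B)) = (k - card A) * of_bool (A \<subseteq> B)"
  proof (cases "A \<subseteq> B")
    case True
    then have "{x\<in>X - A. insert x A \<subseteq> B} = B - A" using B by auto
    then have "card {x\<in>X - A. insert x A \<subseteq> B} = k - card A"
      using True B by (simp add: card_Diff_subset finite_subset)
    then show ?thesis
      using True assms(1) by (simp add: Int_def)
  qed auto
  then show ?case
    using add by (simp add: degree_in_add_mset sum.distrib algebra_simps)
qed

text \<open>Descending induction from \<open>card A = t\<close>: adding one point multiplies both
  degrees by the same positive factor \<open>k - card A\<close>.\<close>

lemma trade_degree_in_eq:
  assumes "is_trade t v k X T" "A \<subseteq> X" "card A \<le> t"
  shows "degree_in (fst T) A = degree_in (snd T) A"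
proof -
  have fin: "finite X" and T: "set_mset (fst T) \<subseteq> nsets X k" "set_mset (snd T) \<subseteq> nsets X k"
    and "t < k"
    using assms(1) by (auto simp: is_trade_def)
  show ?thesis
    using assms(3,2)
  proof (induction "t - card A" arbitrary: A)
    case 0
    moreover have "finite A" using 0 fin finite_subset by blast
    ultimately show ?case
      using assms(1) by (simp add: is_trade_def nsets_def)
  next
    case (Suc n)
    have "finite A" using Suc.prems fin finite_subset by blast
    have "degree_in (fst T) (insert x A) = degree_in (snd T) (insert x A)" if "x \<in> X - A" for x
      using Suc.hyps(2) Suc.prems that \<open>finite A\<close> by (intro Suc.hyps(1)) auto
    then have "(k - card A) * degree_in (fst T) A = (k - card A) * degree_in (snd T) A"
      using sum_degree_in_insert[OF fin Suc.prems(2)] T by (metis (no_types, lifting) sum.cong)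
    moreover have "card A < k"
      using Suc.hyps(2) \<open>t < k\<close> by linarith
    ultimately show ?case by simp
  qed
qed

lemma size_filter_mset_le_one:
  assumes "\<And>B. count T B \<le> 1"
  shows "size (filter_mset P T) = card {B\<in>set_mset T. P B}"
proof -
  have "T = mset_set (set_mset T)"
    by (rule multiset_eqI) (metis assms count_eq_zero_iff count_mset_set(1,3) finite_set_mset
        le_antisym less_one not_le)
  then have "filter_mset P T = mset_set {B\<in>set_mset T. P B}"
    by (metis filter_mset_mset_set finite_set_mset)
  then show ?thesis by simp
qed

text \<open>A repeated block would cover each of its \<open>t\<close>-subsets twice. Hence the parts
  of a Steiner trade are sets.\<close>

lemma steiner_trade_count_le_one:
  assumes "set_mset T \<subseteq> nsets X k" "t \<le> k" "\<And>A. A \<in> nsets X t \<Longrightarrow> degree_in T A \<le> 1"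
  shows "count T B \<le> 1"
proof (cases "B \<in># T")
  case True
  then have "B \<subseteq> X" "finite B" "t \<le> card B"
    using assms(1,2) by (auto simp: nsets_def)
  then obtain A where A: "A \<subseteq> B" "card A = t" "finite A"
    by (metis obtain_subset_with_card_n)
  have "count T B = count {#B \<in># T. A \<subseteq> B#} B" using A by simp
  also have "\<dots> \<le> degree_in T A"
    unfolding degree_in_def by (rule count_le_size)
  also have "\<dots> \<le> 1"
    using A \<open>B \<subseteq> X\<close> by (intro assms(3)) (auto simp: nsets_def)
  finally show ?thesis .
next
  case False
  then show ?thesis by (simp add: not_in_iff)
qed

text \<open>The parts are disjoint and have equal degrees at sets of at most \<open>t\<close>
  points, so the degrees in the union are even.\<close>

lemma steiner_trade_even_strength:
  assumes "is_steiner_trade t v k X T"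
  defines "S \<equiv> set_mset (fst T) \<union> set_mset (snd T)"
  shows "even_strength (Suc t) S" "card S = 2 * volume T"
proof -
  have tr: "is_trade t v k X T" using assms(1) by (simp add: is_steiner_trade_def)
  have fin: "finite X" and T: "set_mset (fst T) \<subseteq> nsets X k" "set_mset (snd T) \<subseteq> nsets X k"
    and disj: "set_mset (fst T) \<inter> set_mset (snd T) = {}" and "t \<le> k"
    using tr by (auto simp: is_trade_def)
  have "count (fst T) B \<le> 1" "count (snd T) B \<le> 1" for B
    by (rule steiner_trade_count_le_one[OF _ \<open>t \<le> k\<close>, of _ X];
        use T assms(1) in \<open>simp add: is_steiner_trade_def\<close>)+
  note size_filter = this[THEN size_filter_mset_le_one]
  have card_S: "card {B\<in>S. A \<subseteq> B} = degree_in (fst T) A + degree_in (snd T) A" for A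
  proof -
    have "{B\<in>S. A \<subseteq> B} = {B\<in>set_mset (fst T). A \<subseteq> B} \<union> {B\<in>set_mset (snd T). A \<subseteq> B}"
      by (auto simp: S_def)
    then show ?thesis
      using disj by (simp add: degree_in_def size_filter card_Un_disjoint disjoint_iff)
  qed
  show "card S = 2 * volume T"
    using card_S[of "{}"] volume_eq_size_snd[OF tr] by (simp add: degree_in_def volume_def)
  show "even_strength (Suc t) S"
    unfolding even_strength_def
  proof (intro allI impI)
    fix A :: "'a set"
    assume A: "finite A \<and> card A < Suc t"
    show "even (card {B\<in>S. A \<subseteq> B})"
    proof (cases "A \<subseteq> X")
      case True
      then show ?thesis using card_S trade_degree_in_eq[OF tr] A by simp
    next
      case False
      have "S \<subseteq> Pow X" using T by (auto simp: S_def nsets_def)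
      then have "{B\<in>S. A \<subseteq> B} = {}" using False by blast
      then show ?thesis by (simp only: card.empty even_zero)
    qed
  qed
qed

theorem theorem2:
  fixes t i s v :: nat and X :: "'a set"
  assumes "t \<ge> 3"
    and "i \<in> {0..t - 1}"
    and "2 ^ (t + 1) - 2 ^ (t - i) < s"
    and "s < 2 ^ (t + 1) - 2 ^ (t - i - 1)"
    and "v > t + 1"
    and "finite X" and "card X = v"
  shows "\<not> (\<exists>T. is_steiner_trade t v (t + 1) X T \<and> volume T = s)"
proof
  assume "\<exists>T. is_steiner_trade t v (t + 1) X T \<and> volume T = s"
  then obtain T where T: "is_steiner_trade t v (t + 1) X T" "volume T = s" by blast
  let ?S = "set_mset (fst T) \<union> set_mset (snd T)"
  have "?S \<subseteq> Pow X"
    using T(1) by (auto simp: is_steiner_trade_def is_trade_def nsets_def)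
  moreover note S = steiner_trade_even_strength[OF T(1), unfolded T(2)]
  moreover have "card ?S < 2 ^ Suc (Suc t)"
    using S(2) assms(4) by simp
  ultimately obtain j where j: "int (2 * s) = 2 ^ Suc (Suc t) - 2 ^ j"
    using Kasami_Tokura_weights[OF assms(6)] by metis
  obtain n where n: "t - i = Suc n"
    using assms(1,2) by (cases "t - i") auto
  \<comment> \<open>The natural subtractions in the bounds on \<open>s\<close> do not truncate, so
    they carry over to the integers.\<close>
  have le: "(2::nat) ^ (t - i) \<le> 2 ^ (t + 1)" "(2::nat) ^ (t - i - 1) \<le> 2 ^ (t + 1)"
    by (rule power_increasing; simp)+
  have "int (2 ^ (t + 1)) - int (2 ^ (t - i)) < int s" "int s < int (2 ^ (t + 1)) - int (2 ^ (t - i - 1))"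
    using assms(3,4) le by linarith+
  \<comment> \<open>Doubling the bounds on \<open>s\<close> puts \<open>2 ^ j\<close> strictly
    between the consecutive powers \<open>2 ^ (t - i)\<close> and
    \<open>2 ^ (t - i + 1)\<close>.\<close>
  then have "(2::int) ^ j < 2 ^ Suc (Suc n)" "(2::int) ^ Suc n < 2 ^ j"
    using j n by simp_all
  then have "j < Suc (Suc n)" "Suc n < j"
    by (simp_all only: power_strict_increasing_iff one_less_numeral_iff semiring_norm)
  then show False by simp
qed

end
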